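(* Let $n\ge 3$ and let $o$ be a vertex of the cycle $C_n$. For the pile process on $C_n$ started from $\eta_0=n\delta_o$, (surely) $$\tau_n\ \ge\ \sum_{v\in C_n} d(o,v)=\left\lfloor\frac{n^2}{4}\right\rfloor,$$ where $d$ is the graph distance on $C_n$ and $\tau_n$ is the hitting time of the configuration with height one at every vertex. Consequently $\mathbb E_o\tau_n=\Omega(n^2)$ as $n\to\infty$.
   Context: The pile process on a finite connected graph $G=(V,E)$ is the following discrete-time Markov chain. A state is a function $\eta:V\to\{0,1,2,\dots\}$; $\eta(x)$ is the number of particles (the height) at $x$. Write $F(\eta)=\{x\in V:\exists y\sim x,\ \eta(y)<\eta(x)\}$ (the free vertices), and for $x\in F(\eta)$ let $M_x(\eta)=\{y\sim x:\eta(y)=\min_{z\sim x}\eta(z)\}$. Let $S(\eta)=\sum_{z\in F(\eta)}\eta(z)$. If $F(\eta)=\emptyset$ the chain stays at $\eta$. Otherwise the transition probabilities are $$P(\eta,\eta-\delta_x+\delta_y)=\frac{\eta(x)}{S(\eta)}\cdot\frac1{|M_x(\eta)|},\qquad x\in F(\eta),\ y\in M_x(\eta),$$ and all other transition probabilities are zero. Here $G=C_n$ is the cycle with $n$ vertices, and the initial state $n\delta_o$ has $n$ particles at $o$ and none elsewhere. The state with height one at every vertex is the unique absorbing state with $n$ particles, and $\tau_n$ is its hitting time (taking the value $\infty$ if it is never hit). $\mathbb E_o$ is expectation for the chain started at $n\delta_o$. *)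

theory Defs
  imports "HOL-Probability.Probability" "Graph_Theory.Graph_Theory"
begin

section \<open>Graphs\<close>

text \<open>
  Finite simple graphs are the library's \<^locale>\<open>pair_graph\<close>s: finite, symmetric, loop-free, with
  an edge represented by its two arcs.
\<close>

definition nbrs :: "'a pair_pre_digraph \<Rightarrow> 'a \<Rightarrow> 'a set" where
  "nbrs G x = {y. (x, y) \<in> parcs G}"

definition graph_dist :: "'a pair_pre_digraph \<Rightarrow> 'a \<Rightarrow> 'a \<Rightarrow> nat" where
  "graph_dist G u v = (LEAST k. \<exists>p. pre_digraph.awalk (with_proj G) u p v \<and> length p = k)"

definition cycle_graph :: "nat \<Rightarrow> nat pair_pre_digraph" where
  "cycle_graph n =
     \<lparr>pverts = {..<n},
      parcs = {(i, j). i < n \<and> j < n \<and> (j = (i + 1) mod n \<or> i = (j + 1) mod n)}\<rparr>"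

lemma pair_graph_cycle_graph:
  assumes "n \<ge> 3"
  shows "pair_graph (cycle_graph n)"
proof
  show "finite (parcs (cycle_graph n))"
    by (rule finite_subset[of _ "{..<n} \<times> {..<n}"]) (auto simp: cycle_graph_def)
  show "symmetric (with_proj (cycle_graph n))"
    by (auto simp: symmetric_def cycle_graph_def intro!: symI)
  show "fst e \<noteq> snd e" if "e \<in> parcs (cycle_graph n)" for e
  proof -
    have "(i + 1) mod n \<noteq> i" if "i < n" for i
      using assms that by (cases "i + 1 = n") auto
    then show ?thesis
      using that by (fastforce simp: cycle_graph_def)
  qed
qed (auto simp: cycle_graph_def)


section \<open>The pile process\<close>

text \<open>
  A configuration assigns a height to every element of the vertex type; only the heights on
  \<^term>\<open>pverts G\<close> matter, and the initial configurations considered are \<open>0\<close> elsewhere.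
\<close>

type_synonym 'a config = "'a \<Rightarrow> nat"

definition free_vertices :: "'a pair_pre_digraph \<Rightarrow> 'a config \<Rightarrow> 'a set" where
  "free_vertices G \<eta> = {x \<in> pverts G. \<exists>y \<in> nbrs G x. \<eta> y < \<eta> x}"

definition lowest_nbrs :: "'a pair_pre_digraph \<Rightarrow> 'a config \<Rightarrow> 'a \<Rightarrow> 'a set" where
  "lowest_nbrs G \<eta> x = {y \<in> nbrs G x. \<eta> y = Min (\<eta> ` nbrs G x)}"

definition free_mass :: "'a pair_pre_digraph \<Rightarrow> 'a config \<Rightarrow> nat" where
  "free_mass G \<eta> = (\<Sum>z \<in> free_vertices G \<eta>. \<eta> z)"

definition move :: "'a config \<Rightarrow> 'a \<Rightarrow> 'a \<Rightarrow> 'a config" where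
  "move \<eta> x y = \<eta>(x := \<eta> x - 1, y := \<eta> y + 1)"

definition free_vertex_pmf :: "'a pair_pre_digraph \<Rightarrow> 'a config \<Rightarrow> 'a pmf" where
  "free_vertex_pmf G \<eta> =
     embed_pmf (\<lambda>x. if x \<in> free_vertices G \<eta> then real (\<eta> x) / real (free_mass G \<eta>) else 0)"

definition pile_step :: "'a pair_pre_digraph \<Rightarrow> 'a config \<Rightarrow> 'a config pmf" where
  "pile_step G \<eta> =
     (if free_vertices G \<eta> = {} then return_pmf \<eta>
      else bind_pmf (free_vertex_pmf G \<eta>) (\<lambda>x. map_pmf (move \<eta> x) (pmf_of_set (lowest_nbrs G \<eta> x))))"

text \<open>The transition probabilities of \<^const>\<open>pile_step\<close> in closed form.\<close>

context
  fixes G :: "'a pair_pre_digraph"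
  assumes G: "pair_graph G"
begin

interpretation pair_graph G by (fact G)

lemma finite_nbrs: "finite (nbrs G x)"
proof -
  have "nbrs G x \<subseteq> snd ` parcs G"
    by (force simp: nbrs_def)
  then show ?thesis
    using pair_finite_arcs finite_surj by blast
qed

lemma finite_free_vertices: "finite (free_vertices G \<eta>)"
  using pair_finite_verts by (simp add: free_vertices_def)

lemma lowest_nbrs_nonempty:
  assumes "x \<in> free_vertices G \<eta>"
  shows "lowest_nbrs G \<eta> x \<noteq> {}"
proof -
  have "Min (\<eta> ` nbrs G x) \<in> \<eta> ` nbrs G x"
    using assms finite_nbrs by (intro Min_in) (auto simp: free_vertices_def)
  then show ?thesis
    by (auto simp: lowest_nbrs_def)
qed

lemma finite_lowest_nbrs: "finite (lowest_nbrs G \<eta> x)"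
  using finite_nbrs by (simp add: lowest_nbrs_def)

lemma pmf_free_vertex_pmf:
  assumes "free_vertices G \<eta> \<noteq> {}"
  shows "pmf (free_vertex_pmf G \<eta>) x =
    (if x \<in> free_vertices G \<eta> then real (\<eta> x) / real (free_mass G \<eta>) else 0)"
  unfolding free_vertex_pmf_def
proof (rule pmf_embed_pmf)
  let ?F = "free_vertices G \<eta>"
  obtain z where z: "z \<in> ?F"
    using assms by auto
  moreover from z have "\<eta> z > 0"
    by (auto simp: free_vertices_def)
  ultimately have pos: "free_mass G \<eta> > 0"
    unfolding free_mass_def using finite_free_vertices by (meson sum_pos2 zero_le)
  have "(\<integral>\<^sup>+x. ennreal (if x \<in> ?F then real (\<eta> x) / real (free_mass G \<eta>) else 0) \<partial>count_space UNIV)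
      = (\<Sum>x\<in>?F. ennreal (real (\<eta> x) / real (free_mass G \<eta>)))"
    by (subst nn_integral_count_space'[OF finite_free_vertices[of \<eta>]]) auto
  also have "\<dots> = ennreal (\<Sum>x\<in>?F. real (\<eta> x) / real (free_mass G \<eta>))"
    by (subst sum_ennreal) auto
  also have "(\<Sum>x\<in>?F. real (\<eta> x) / real (free_mass G \<eta>)) = 1"
    using pos by (simp add: free_mass_def flip: sum_divide_distrib of_nat_sum)
  finally show "(\<integral>\<^sup>+x. ennreal (if x \<in> ?F then real (\<eta> x) / real (free_mass G \<eta>) else 0)
      \<partial>count_space UNIV) = 1" by simp
qed auto

lemma set_pmf_free_vertex_pmf:
  assumes "free_vertices G \<eta> \<noteq> {}"
  shows "set_pmf (free_vertex_pmf G \<eta>) = free_vertices G \<eta>"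
proof -
  have "\<eta> x > 0" "\<eta> x \<le> free_mass G \<eta>" if "x \<in> free_vertices G \<eta>" for x
    using that finite_free_vertices by (auto simp: free_vertices_def free_mass_def intro!: member_le_sum)
  then show ?thesis
    using assms by (force simp: set_pmf_eq pmf_free_vertex_pmf)
qed

lemma set_pmf_pile_step:
  assumes "free_vertices G \<eta> \<noteq> {}"
  shows "set_pmf (pile_step G \<eta>) =
    {move \<eta> x y |x y. x \<in> free_vertices G \<eta> \<and> y \<in> lowest_nbrs G \<eta> x}"
  using assms lowest_nbrs_nonempty finite_lowest_nbrs
  by (auto simp: pile_step_def set_pmf_free_vertex_pmf set_pmf_of_set)

lemma move_inj:
  assumes "x \<in> free_vertices G \<eta>" "y \<in> lowest_nbrs G \<eta> x"
    and "x' \<in> free_vertices G \<eta>" "y' \<in> lowest_nbrs G \<eta> x'"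
    and eq: "move \<eta> x y = move \<eta> x' y'"
  shows "x = x' \<and> y = y'"
proof -
  have ne: "x \<noteq> y" "x' \<noteq> y'" and pos: "\<eta> x > 0" "\<eta> x' > 0"
    using assms(1-4) pair_no_loops[of "(x, y)"] pair_no_loops[of "(x', y')"]
    by (auto simp: lowest_nbrs_def nbrs_def free_vertices_def)
  have "move \<eta> x y z = move \<eta> x' y' z" for z
    using eq by simp
  from this[of x] this[of y] this[of x'] this[of y'] show ?thesis
    using ne pos by (auto simp: move_def split: if_splits)
qed

lemma pmf_pile_step:
  assumes x: "x \<in> free_vertices G \<eta>" and y: "y \<in> lowest_nbrs G \<eta> x"
  shows "pmf (pile_step G \<eta>) (move \<eta> x y) =
    real (\<eta> x) / real (free_mass G \<eta>) * (1 / real (card (lowest_nbrs G \<eta> x)))"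
proof -
  let ?F = "free_vertices G \<eta>"
  let ?q = "\<lambda>x'. pmf (map_pmf (move \<eta> x') (pmf_of_set (lowest_nbrs G \<eta> x'))) (move \<eta> x y)"
  have F: "?F \<noteq> {}" using x by auto
  have q0: "?q x' = 0" if "x' \<in> ?F" "x' \<noteq> x" for x'
    using that move_inj[OF x y] lowest_nbrs_nonempty finite_lowest_nbrs
    by (auto simp: pmf_eq_0_set_pmf set_pmf_of_set)
  have "inj_on (move \<eta> x) (set_pmf (pmf_of_set (lowest_nbrs G \<eta> x)))"
    using move_inj[OF x _ x] lowest_nbrs_nonempty[OF x] finite_lowest_nbrs
    by (auto simp: inj_on_def set_pmf_of_set)
  moreover have "y \<in> set_pmf (pmf_of_set (lowest_nbrs G \<eta> x))"
    using y finite_lowest_nbrs by (subst set_pmf_of_set) auto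
  ultimately have q1: "?q x = 1 / real (card (lowest_nbrs G \<eta> x))"
    using y lowest_nbrs_nonempty[OF x] finite_lowest_nbrs
    by (subst pmf_map_inj) auto
  have "pmf (pile_step G \<eta>) (move \<eta> x y) = (\<integral>x'. ?q x' \<partial>measure_pmf (free_vertex_pmf G \<eta>))"
    using F by (simp add: pile_step_def pmf_bind)
  also have "\<dots> = (\<Sum>x'\<in>?F. ?q x' * pmf (free_vertex_pmf G \<eta>) x')"
    using F finite_free_vertices
    by (intro integral_measure_pmf_real) (auto simp: set_pmf_free_vertex_pmf)
  also have "\<dots> = (\<Sum>x'\<in>{x}. ?q x' * pmf (free_vertex_pmf G \<eta>) x')"
    using x finite_free_vertices q0 by (intro sum.mono_neutral_right) auto
  finally show ?thesis
    using x F by (simp add: q1 pmf_free_vertex_pmf)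
qed

end


section \<open>Trajectories\<close>

definition pile_kernel ::
  "'a pair_pre_digraph \<Rightarrow> 'a config \<Rightarrow> nat \<Rightarrow> (nat \<Rightarrow> 'a config) \<Rightarrow> 'a config pmf" where
  "pile_kernel G \<eta>\<^sub>0 t \<omega> = (case t of 0 \<Rightarrow> return_pmf \<eta>\<^sub>0 | Suc s \<Rightarrow> pile_step G (\<omega> s))"

text \<open>
  The law of the chain started at \<open>\<eta>\<^sub>0\<close>, as a measure on the space of all sequences of
  configurations; it is the projective limit provided by the Ionescu-Tulcea theorem.
\<close>

definition pile_process :: "'a pair_pre_digraph \<Rightarrow> 'a config \<Rightarrow> (nat \<Rightarrow> 'a config) measure" where
  "pile_process G \<eta>\<^sub>0 =
     projective_family.lim UNIV
       (Ionescu_Tulcea.CI (\<lambda>t \<omega>. measure_pmf (pile_kernel G \<eta>\<^sub>0 t \<omega>)) (\<lambda>_. count_space UNIV))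
       (\<lambda>_. count_space UNIV)"

text \<open>The possible trajectories: every step has positive probability.\<close>

definition pile_paths :: "'a pair_pre_digraph \<Rightarrow> 'a config \<Rightarrow> (nat \<Rightarrow> 'a config) set" where
  "pile_paths G \<eta>\<^sub>0 = {\<omega>. \<omega> 0 = \<eta>\<^sub>0 \<and> (\<forall>t. pmf (pile_step G (\<omega> t)) (\<omega> (Suc t)) > 0)}"

text \<open>The infimum of the empty set is \<open>\<infinity>\<close>.\<close>

definition hitting_time :: "'s \<Rightarrow> (nat \<Rightarrow> 's) \<Rightarrow> enat" where
  "hitting_time s \<omega> = (INF t \<in> {t. \<omega> t = s}. enat t)"

definition point_pile :: "nat \<Rightarrow> 'a \<Rightarrow> 'a config" where
  "point_pile n u = (\<lambda>v. if v = u then n else 0)"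

definition flat_pile :: "'a pair_pre_digraph \<Rightarrow> 'a config" where
  "flat_pile G = (\<lambda>v. if v \<in> pverts G then 1 else 0)"


subsection \<open>Basic properties of the law of the chain\<close>

interpretation pile: Ionescu_Tulcea
  "\<lambda>t \<omega>. measure_pmf (pile_kernel G \<eta>\<^sub>0 t \<omega>)" "\<lambda>_. count_space UNIV"
  for G :: "'a pair_pre_digraph" and \<eta>\<^sub>0 :: "'a config"
proof
  fix t
  show "(\<lambda>\<omega>. measure_pmf (pile_kernel G \<eta>\<^sub>0 t \<omega>))
      \<in> Pi\<^sub>M {0..<t} (\<lambda>_. count_space UNIV) \<rightarrow>\<^sub>M subprob_algebra (count_space UNIV)"
  proof (cases t)
    case 0
    then show ?thesis
      by (simp add: pile_kernel_def measure_pmf_in_subprob_algebra)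
  next
    case (Suc s)
    have coord: "(\<lambda>\<omega>. \<omega> s) \<in> Pi\<^sub>M {0..<t} (\<lambda>_. count_space UNIV :: 'a config measure) \<rightarrow>\<^sub>M count_space UNIV"
      using Suc by (intro measurable_component_singleton) auto
    have step: "(\<lambda>\<eta>. measure_pmf (pile_step G \<eta>)) \<in> count_space UNIV \<rightarrow>\<^sub>M subprob_algebra (count_space UNIV)"
      by (auto simp: measure_pmf_in_subprob_algebra)
    show ?thesis
      using measurable_compose[OF coord step] by (simp add: pile_kernel_def Suc)
  qed
qed

lemma pile_process_eq: "pile_process G \<eta>\<^sub>0 = pile.PF.lim G \<eta>\<^sub>0"
  by (simp add: pile_process_def)

lemma sets_pile_process [measurable_cong, simp]:
  "sets (pile_process G \<eta>\<^sub>0) = sets (Pi\<^sub>M UNIV (\<lambda>_. count_space UNIV))"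
  by (simp add: pile_process_eq)

lemma space_pile_process [simp]: "space (pile_process G \<eta>\<^sub>0) = UNIV"
  by (simp add: pile_process_eq space_PiM)

text \<open>The first \<open>k\<close> configurations of the chain, as a discrete distribution.\<close>

primrec prefix_pmf :: "'a pair_pre_digraph \<Rightarrow> 'a config \<Rightarrow> nat \<Rightarrow> (nat \<Rightarrow> 'a config) pmf" where
  "prefix_pmf G \<eta>\<^sub>0 0 = return_pmf (\<lambda>_. undefined)"
| "prefix_pmf G \<eta>\<^sub>0 (Suc k) =
     bind_pmf (prefix_pmf G \<eta>\<^sub>0 k) (\<lambda>\<omega>. map_pmf (fun_upd \<omega> k) (pile_kernel G \<eta>\<^sub>0 k \<omega>))"

lemma pile_kernel_cong:
  "(\<And>i. i < k \<Longrightarrow> \<omega> i = \<omega>' i) \<Longrightarrow> pile_kernel G \<eta>\<^sub>0 k \<omega> = pile_kernel G \<eta>\<^sub>0 k \<omega>'"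
  by (auto simp: pile_kernel_def split: nat.split)

lemma C_eq_distr_prefix_pmf:
  "pile.C G \<eta>\<^sub>0 0 k (\<lambda>_. undefined) =
   distr (measure_pmf (prefix_pmf G \<eta>\<^sub>0 k)) (Pi\<^sub>M {0..<k} (\<lambda>_. count_space UNIV))
     (\<lambda>\<omega>. restrict \<omega> {0..<k})"
proof (induction k)
  case 0
  show ?case
    by (intro measure_eqI) (auto simp: emeasure_distr space_PiM indicator_def restrict_def)
next
  case (Suc k)
  let ?N = "\<lambda>_::nat. count_space UNIV :: 'a config measure"
  let ?u = "\<lambda>_::nat. undefined :: 'a config"
  have sp: "?u \<in> space (Pi\<^sub>M {0..<0} ?N)"
    by (simp add: space_PiM)
  have r: "restrict \<omega> {0..<j} \<in> space (Pi\<^sub>M {0..<j} ?N)" for \<omega> j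
    by (simp add: space_PiM)
  show ?case
  proof (rule measure_eqI)
    show "sets (pile.C G \<eta>\<^sub>0 0 (Suc k) ?u) = sets (distr (measure_pmf (prefix_pmf G \<eta>\<^sub>0 (Suc k)))
        (Pi\<^sub>M {0..<Suc k} ?N) (\<lambda>\<omega>. restrict \<omega> {0..<Suc k}))"
      using pile.sets_C[OF sp, of G \<eta>\<^sub>0 "Suc k"] by (simp del: pile.C.simps)
    fix A assume "A \<in> sets (pile.C G \<eta>\<^sub>0 0 (Suc k) ?u)"
    then have A: "A \<in> sets (Pi\<^sub>M {0..<Suc k} ?N)"
      using pile.sets_C[OF sp, of G \<eta>\<^sub>0 "Suc k"] by (simp del: pile.C.simps)
    have eP: "pile.eP G \<eta>\<^sub>0 k \<in> Pi\<^sub>M {0..<k} ?N \<rightarrow>\<^sub>M subprob_algebra (Pi\<^sub>M {0..<Suc k} ?N)"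
      by (rule pile.measurable_eP)
    have upd: "restrict (fun_upd \<omega> k \<eta>) {0..<Suc k} = fun_upd (restrict \<omega> {0..<k}) k \<eta>" for \<omega> \<eta>
      by (auto simp: restrict_def fun_eq_iff)
    have ker: "pile_kernel G \<eta>\<^sub>0 k (restrict \<omega> {0..<k}) = pile_kernel G \<eta>\<^sub>0 k \<omega>" for \<omega>
      by (rule pile_kernel_cong) simp
    have "emeasure (pile.C G \<eta>\<^sub>0 0 (Suc k) ?u) A =
        (\<integral>\<^sup>+x. emeasure (pile.eP G \<eta>\<^sub>0 k x) A \<partial>pile.C G \<eta>\<^sub>0 0 k ?u)"
      using A eP pile.space_C[OF sp, of G \<eta>\<^sub>0 k] pile.sets_C[OF sp, of G \<eta>\<^sub>0 k]
      by (simp, subst emeasure_bind[where N = "Pi\<^sub>M {0..<Suc k} ?N"])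
        (auto simp: space_PiM cong: measurable_cong_sets)
    also have "\<dots> = (\<integral>\<^sup>+\<omega>. emeasure (pile.eP G \<eta>\<^sub>0 k (restrict \<omega> {0..<k})) A
        \<partial>measure_pmf (prefix_pmf G \<eta>\<^sub>0 k))"
      unfolding Suc.IH
      by (rule nn_integral_distr)
        (use A eP r in \<open>auto intro: measurable_emeasure_kernel\<close>)
    also have "\<dots> = (\<integral>\<^sup>+\<omega>. emeasure (measure_pmf (pile_kernel G \<eta>\<^sub>0 k \<omega>))
        {\<eta>. restrict (fun_upd \<omega> k \<eta>) {0..<Suc k} \<in> A} \<partial>measure_pmf (prefix_pmf G \<eta>\<^sub>0 k))"
      using pile.emeasure_eP[OF r A] by (simp add: upd ker vimage_def)
    also have "\<dots> = emeasure (distr (measure_pmf (prefix_pmf G \<eta>\<^sub>0 (Suc k)))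
        (Pi\<^sub>M {0..<Suc k} ?N) (\<lambda>\<omega>. restrict \<omega> {0..<Suc k})) A"
      using A r by (subst emeasure_distr) (auto simp: vimage_def)
    finally show "emeasure (pile.C G \<eta>\<^sub>0 0 (Suc k) ?u) A = \<dots>" .
  qed
qed

lemma prob_space_pile_process: "prob_space (pile_process G \<eta>\<^sub>0)"
proof
  have "emeasure (pile.PF.lim G \<eta>\<^sub>0) (prod_emb UNIV (\<lambda>_. count_space UNIV) {} (space (Pi\<^sub>M {} (\<lambda>_. count_space UNIV))))
     = emeasure (pile.CI G \<eta>\<^sub>0 {}) (space (Pi\<^sub>M {} (\<lambda>_. count_space UNIV)))"
    by (rule pile.lim) auto
  also have "\<dots> = 1"
    using prob_space.emeasure_space_1[OF pile.PF.prob_space_P, of "{}" G \<eta>\<^sub>0]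
    by (simp add: pile.CI_def)
  finally show "emeasure (pile_process G \<eta>\<^sub>0) (space (pile_process G \<eta>\<^sub>0)) = 1"
    by (simp add: pile_process_eq space_PiM prod_emb_def vimage_def restrict_def)
qed

lemma emeasure_pile_process_prefix:
  assumes X: "X \<in> sets (Pi\<^sub>M {0..<k} (\<lambda>_. count_space UNIV))"
  shows "emeasure (pile_process G \<eta>\<^sub>0) {\<omega>. restrict \<omega> {0..<k} \<in> X} =
    emeasure (measure_pmf (prefix_pmf G \<eta>\<^sub>0 k)) {\<omega>. restrict \<omega> {0..<k} \<in> X}"
proof -
  let ?N = "\<lambda>_::nat. count_space UNIV :: 'a config measure"
  have emb: "prod_emb UNIV ?N {0..<k} X = {\<omega>. restrict \<omega> {0..<k} \<in> X}"
    by (auto simp: prod_emb_def)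
  have emb': "prod_emb {0..<k} ?N {0..<k} X = X"
    using sets.sets_into_space[OF X] by (intro prod_emb_id) (simp add: space_PiM)
  have "emeasure (pile_process G \<eta>\<^sub>0) {\<omega>. restrict \<omega> {0..<k} \<in> X} = emeasure (pile.CI G \<eta>\<^sub>0 {0..<k}) X"
    using pile.lim[OF _ X, of G \<eta>\<^sub>0] by (simp add: emb pile_process_eq)
  also have "\<dots> = emeasure (pile.C G \<eta>\<^sub>0 0 k (\<lambda>_. undefined)) X"
    using pile.emeasure_CI[of "{0..<k}" k X G \<eta>\<^sub>0] X by (simp add: emb')
  also have "\<dots> = emeasure (measure_pmf (prefix_pmf G \<eta>\<^sub>0 k)) {\<omega>. restrict \<omega> {0..<k} \<in> X}"
    using X by (subst C_eq_distr_prefix_pmf, subst emeasure_distr) (auto simp: space_PiM vimage_def)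
  finally show ?thesis .
qed

lemma singleton_sets_PiM:
  fixes s :: "nat \<Rightarrow> 'a config"
  shows "{restrict s {0..<k}} \<in> sets (Pi\<^sub>M {0..<k} (\<lambda>_. count_space UNIV))"
proof -
  have "{restrict s {0..<k}} = Pi\<^sub>E {0..<k} (\<lambda>i. {s i})"
  proof -
    have "Pi\<^sub>E {0..<k} (\<lambda>i. {restrict s {0..<k} i}) = {restrict s {0..<k}}"
      by (rule PiE_singleton) (rule restrict_extensional)
    moreover have "Pi\<^sub>E {0..<k} (\<lambda>i. {restrict s {0..<k} i}) = Pi\<^sub>E {0..<k} (\<lambda>i. {s i})"
      by (rule PiE_cong) simp
    ultimately show ?thesis
      by simp
  qed
  then show ?thesis
    by (auto intro!: sets_PiM_I_finite)
qed

lemma emeasure_prefix_pmf: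
  "emeasure (measure_pmf (prefix_pmf G \<eta>\<^sub>0 k)) {\<omega>. \<forall>i<k. \<omega> i = s i} =
    (\<Prod>i<k. ennreal (pmf (pile_kernel G \<eta>\<^sub>0 i s) (s i)))"
proof (induction k)
  case (Suc k)
  have "emeasure (measure_pmf (pile_kernel G \<eta>\<^sub>0 k \<omega>)) {\<eta>. \<forall>i<Suc k. fun_upd \<omega> k \<eta> i = s i} =
      ennreal (pmf (pile_kernel G \<eta>\<^sub>0 k s) (s k)) * indicator {\<omega>. \<forall>i<k. \<omega> i = s i} \<omega>" for \<omega>
  proof (cases "\<forall>i<k. \<omega> i = s i")
    case True
    then have "{\<eta>. \<forall>i<Suc k. fun_upd \<omega> k \<eta> i = s i} = {s k}"
      by (auto simp: less_Suc_eq)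
    then show ?thesis
      using True pile_kernel_cong[of k \<omega> s G \<eta>\<^sub>0] by (simp add: emeasure_pmf_single)
  next
    case False
    then have "{\<eta>. \<forall>i<Suc k. fun_upd \<omega> k \<eta> i = s i} = {}"
      by (fastforce simp: less_Suc_eq)
    then show ?thesis
      using False by (simp del: Collect_empty_eq)
  qed
  then show ?case
    by (simp add: vimage_def nn_integral_cmult Suc.IH mult.commute)
qed auto

text \<open>The Markov property, in the form of the probabilities of the cylinder sets.\<close>

theorem emeasure_pile_process_cylinder:
  "emeasure (pile_process G \<eta>\<^sub>0) {\<omega>. \<forall>i\<le>k. \<omega> i = s i} =
    (if s 0 = \<eta>\<^sub>0 then \<Prod>i<k. ennreal (pmf (pile_step G (s i)) (s (Suc i))) else 0)"
proof -
  have eq: "restrict \<omega> {0..<Suc k} \<in> {restrict s {0..<Suc k}} \<longleftrightarrow> (\<forall>i<Suc k. \<omega> i = s i)"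
    for \<omega> :: "nat \<Rightarrow> 'a config"
    by (auto simp: restrict_def fun_eq_iff)
  have "emeasure (pile_process G \<eta>\<^sub>0) {\<omega>. \<forall>i\<le>k. \<omega> i = s i} =
      (\<Prod>i<Suc k. ennreal (pmf (pile_kernel G \<eta>\<^sub>0 i s) (s i)))"
    using emeasure_pile_process_prefix[OF singleton_sets_PiM, of G \<eta>\<^sub>0 "Suc k" s]
    unfolding eq emeasure_prefix_pmf by (simp only: less_Suc_eq_le)
  also have "\<dots> = ennreal (pmf (return_pmf \<eta>\<^sub>0) (s 0)) *
      (\<Prod>i<k. ennreal (pmf (pile_step G (s i)) (s (Suc i))))"
    by (subst prod.lessThan_Suc_shift) (simp add: pile_kernel_def)
  finally show ?thesis
    by (auto simp: indicator_def)
qed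

theorem AE_pile_paths: "AE \<omega> in pile_process G \<eta>\<^sub>0. \<omega> \<in> pile_paths G \<eta>\<^sub>0"
proof -
  let ?X = "\<lambda>k. (\<lambda>\<omega>. restrict \<omega> {0..<k}) ` set_pmf (prefix_pmf G \<eta>\<^sub>0 k)"
  have supp: "\<omega> i \<in> set_pmf (pile_kernel G \<eta>\<^sub>0 i \<omega>)" if "\<omega> \<in> set_pmf (prefix_pmf G \<eta>\<^sub>0 k)" "i < k" for \<omega> i k
    using that
  proof (induction k arbitrary: \<omega>)
    case (Suc k)
    then obtain \<omega>' \<eta> where *: "\<omega>' \<in> set_pmf (prefix_pmf G \<eta>\<^sub>0 k)"
      "\<eta> \<in> set_pmf (pile_kernel G \<eta>\<^sub>0 k \<omega>')" "\<omega> = fun_upd \<omega>' k \<eta>"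
      by auto
    have ker: "pile_kernel G \<eta>\<^sub>0 i \<omega> = pile_kernel G \<eta>\<^sub>0 i \<omega>'"
      using Suc.prems * by (intro pile_kernel_cong) auto
    have "\<omega> i \<in> set_pmf (pile_kernel G \<eta>\<^sub>0 i \<omega>')"
      using Suc.IH[OF *(1)] Suc.prems(2) *(2,3) by (cases "i = k") auto
    then show ?case
      by (simp only: ker)
  qed simp
  interpret prob_space "pile_process G \<eta>\<^sub>0"
    by (rule prob_space_pile_process)
  have "AE \<omega> in pile_process G \<eta>\<^sub>0. restrict \<omega> {0..<k} \<in> ?X k" for k
  proof -
    have "?X k = (\<Union>s \<in> set_pmf (prefix_pmf G \<eta>\<^sub>0 k). {restrict s {0..<k}})"
      by auto
    then have X: "?X k \<in> sets (Pi\<^sub>M {0..<k} (\<lambda>_. count_space UNIV))"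
      using singleton_sets_PiM by (auto intro!: sets.countable_UN'')
    have "emeasure (measure_pmf (prefix_pmf G \<eta>\<^sub>0 k)) {\<omega>. restrict \<omega> {0..<k} \<in> ?X k} = 1"
      by (rule measure_pmf.emeasure_eq_1_AE) (auto simp: AE_measure_pmf_iff)
    then have "prob {\<omega>. restrict \<omega> {0..<k} \<in> ?X k} = 1"
      using emeasure_pile_process_prefix[OF X, of G \<eta>\<^sub>0] by (simp add: measure_def)
    from AE_prob_1[OF this] show ?thesis
      by simp
  qed
  then have "AE \<omega> in pile_process G \<eta>\<^sub>0. \<forall>k. restrict \<omega> {0..<k} \<in> ?X k"
    by (simp add: AE_all_countable)
  then show ?thesis
  proof (rule eventually_mono)
    fix \<omega> assume \<omega>: "\<forall>k. restrict \<omega> {0..<k} \<in> ?X k"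
    have ker: "\<omega> i \<in> set_pmf (pile_kernel G \<eta>\<^sub>0 i \<omega>)" for i
    proof -
      obtain s where s: "s \<in> set_pmf (prefix_pmf G \<eta>\<^sub>0 (Suc i))"
        "restrict \<omega> {0..<Suc i} = restrict s {0..<Suc i}"
        using \<omega> by blast
      have eq: "\<omega> j = s j" if "j < Suc i" for j
        using fun_cong[OF s(2), of j] that by simp
      have "pile_kernel G \<eta>\<^sub>0 i \<omega> = pile_kernel G \<eta>\<^sub>0 i s"
        using eq by (intro pile_kernel_cong) auto
      then show ?thesis
        using supp[OF s(1), of i] eq[of i] by simp
    qed
    show "\<omega> \<in> pile_paths G \<eta>\<^sub>0"
      using ker[of 0] ker[of "Suc t" for t]
      by (auto simp: pile_paths_def pile_kernel_def pmf_positive_iff)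
  qed
qed

lemma hitting_time_eq:
  "hitting_time s \<omega> = (if \<exists>t. \<omega> t = s then enat (LEAST t. \<omega> t = s) else \<infinity>)"
proof (cases "\<exists>t. \<omega> t = s")
  case True
  then have "\<omega> (LEAST t. \<omega> t = s) = s"
    by (rule LeastI_ex)
  then have "hitting_time s \<omega> = enat (LEAST t. \<omega> t = s)"
    unfolding hitting_time_def by (intro INF_eqI) (auto intro: Least_le)
  with True show ?thesis
    by simp
qed (simp add: hitting_time_def top_enat_def)

lemma measurable_hitting_time [measurable]:
  "hitting_time s \<in> pile_process G \<eta>\<^sub>0 \<rightarrow>\<^sub>M count_space UNIV"
proof -
  have [measurable]: "Measurable.pred (pile_process G \<eta>\<^sub>0) (\<lambda>\<omega>. \<omega> t = s)" for t
  proof -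
    have "(\<lambda>\<omega>. \<omega> t) \<in> pile_process G \<eta>\<^sub>0 \<rightarrow>\<^sub>M count_space UNIV"
      by (simp add: measurable_component_singleton cong: measurable_cong_sets)
    from measurable_sets[OF this, of "{s}"] show ?thesis
      by (simp add: vimage_def pred_def)
  qed
  show ?thesis
    unfolding hitting_time_eq[abs_def] by measurable
qed

end

theory Submission
  imports Defs
begin

text \<open>
  The bound comes from the potential \<open>\<Phi>(\<eta>) = (\<Sum>v. d(u, v) \<eta>(v))\<close>, the total distance of the
  particles from their common starting vertex \<open>u\<close>. One step of the chain moves at most one particle
  along one edge, and \<open>d(u, \<cdot>)\<close> changes by at most \<open>1\<close> along an edge, so \<open>\<Phi>\<close> grows by at most \<open>1\<close> per
  step (\<open>pile_potential_le\<close>). It is \<open>0\<close> when all particles are at \<open>u\<close> and \<open>(\<Sum>v. d(u, v))\<close> at the flat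
  configuration, so at least that many steps separate the two
  (\<open>hitting_time_flat_pile_ge\<close>). This argument works on every connected graph.

  On the cycle \<open>d(u, v)\<close> is the length of the shorter of the two paths from \<open>u\<close> to \<open>v\<close>
  (\<open>graph_dist_cycle\<close>). Rotating \<open>u\<close> to \<open>0\<close>, the sum of distances becomes
  \<open>(\<Sum>k<n. min k (n - k)) = n\<^sup>2 div 4\<close>. As the bound holds on every trajectory, it holds almost
  surely, and integrating it bounds the expectation.
\<close>


section \<open>Distances in graphs\<close>

lemma graph_dist_le:
  assumes "pre_digraph.awalk (with_proj G) u p v"
  shows "graph_dist G u v \<le> length p"
  unfolding graph_dist_def using assms by (intro Least_le) auto

lemma shortest_awalk:
  assumes "pre_digraph.awalk (with_proj G) u q v"
  obtains p where "pre_digraph.awalk (with_proj G) u p v" "length p = graph_dist G u v"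
  using LeastI_ex[of "\<lambda>k. \<exists>p. pre_digraph.awalk (with_proj G) u p v \<and> length p = k"] assms
  unfolding graph_dist_def by blast

context pair_wf_digraph
begin

lemma awalk_snoc:
  assumes "awalk u p x" "(x, y) \<in> parcs G"
  shows "awalk u (p @ [(x, y)]) y"
  using awalk_appendI[OF assms(1)] arc_implies_awalk[of "(x, y)"] assms(2) by simp

lemma graph_dist_arc_le:
  assumes "awalk u p x" "(x, y) \<in> parcs G"
  shows "graph_dist G u y \<le> graph_dist G u x + 1"
proof -
  obtain q where "awalk u q x" "length q = graph_dist G u x"
    using shortest_awalk[OF assms(1)] .
  then show ?thesis
    using graph_dist_le[OF awalk_snoc[OF _ assms(2)], of u q] by simp
qed

text \<open>Each arc of the walk contributes at most \<open>1\<close>. This is what bounds distances from below.\<close>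

lemma lipschitz_le_awalk_length:
  fixes f :: "'a \<Rightarrow> nat"
  assumes "\<And>x y. (x, y) \<in> parcs G \<Longrightarrow> f y \<le> f x + 1"
    and "awalk u p v"
  shows "f v \<le> f u + length p"
  using assms(2)
proof (induction p arbitrary: u)
  case (Cons e p)
  then have "awalk (snd e) p v" "fst e = u" "e \<in> parcs G"
    by (auto simp: awalk_Cons_iff)
  then show ?case
    using Cons.IH[of "snd e"] assms(1)[of u "snd e"] by (cases e) fastforce
qed (auto simp: awalk_def)

text \<open>
  Descending along the predecessors from \<open>v\<close>, one level at a time, reaches level \<open>0\<close>, that is
  \<open>u\<close>; reversed, this is a walk of length \<open>f v\<close>.
\<close>

lemma awalk_of_levels:
  fixes f :: "'a \<Rightarrow> nat"
  assumes "u \<in> pverts G"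
    and zero: "\<And>v. v \<in> pverts G \<Longrightarrow> f v = 0 \<Longrightarrow> v = u"
    and pred: "\<And>v. v \<in> pverts G \<Longrightarrow> f v > 0 \<Longrightarrow> \<exists>x. (x, v) \<in> parcs G \<and> f v = f x + 1"
    and "v \<in> pverts G"
  shows "\<exists>p. awalk u p v \<and> length p = f v"
  using assms(4)
proof (induction "f v" arbitrary: v)
  case 0
  then show ?case
    using zero[of v] assms(1) by (auto intro!: exI[of _ "[]"] simp: awalk_Nil_iff)
next
  case (Suc k)
  then obtain x where x: "(x, v) \<in> parcs G" "f v = f x + 1"
    using pred[of v] by auto
  moreover have "x \<in> pverts G"
    using x(1) by (auto dest: in_arcsD1)
  ultimately obtain p where "awalk u p x" "length p = f x"
    using Suc.hyps(1)[of x] Suc.hyps(2) by auto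
  then show ?case
    using awalk_snoc[OF _ x(1)] x(2) by (intro exI[of _ "p @ [(x, v)]"]) auto
qed

text \<open>
  A breadth-first layering determines the distance: descending through the layers gives a walk of
  length \<open>f v\<close>, and no walk is shorter because no arc skips a layer.
\<close>

lemma graph_dist_eq_level:
  fixes f :: "'a \<Rightarrow> nat"
  assumes "u \<in> pverts G" "f u = 0"
    and "\<And>v. v \<in> pverts G \<Longrightarrow> f v = 0 \<Longrightarrow> v = u"
    and "\<And>v. v \<in> pverts G \<Longrightarrow> f v > 0 \<Longrightarrow> \<exists>x. (x, v) \<in> parcs G \<and> f v = f x + 1"
    and lip: "\<And>x y. (x, y) \<in> parcs G \<Longrightarrow> f y \<le> f x + 1"
    and "v \<in> pverts G"
  shows "graph_dist G u v = f v"
proof (rule antisym)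
  obtain p where p: "awalk u p v" "length p = f v"
    using awalk_of_levels[of u f v] assms by blast
  then show "graph_dist G u v \<le> f v"
    using graph_dist_le[of G u p v] by simp
  obtain q where "awalk u q v" "length q = graph_dist G u v"
    using shortest_awalk[OF p(1)] .
  then show "f v \<le> graph_dist G u v"
    using lipschitz_le_awalk_length[of f u q v] lip assms(2) by simp
qed

end


section \<open>The potential of a configuration\<close>

definition potential :: "'a pair_pre_digraph \<Rightarrow> ('a \<Rightarrow> nat) \<Rightarrow> 'a config \<Rightarrow> nat" where
  "potential G f \<eta> = (\<Sum>v \<in> pverts G. f v * \<eta> v)"

context pair_graph
begin

text \<open>The increment is \<open>f y - f x\<close>, written additively because subtraction truncates.\<close>

lemma potential_move:
  assumes "(x, y) \<in> parcs G" "\<eta> x > 0"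
  shows "potential G f (move \<eta> x y) + f x = potential G f \<eta> + f y"
proof -
  have xy: "x \<in> pverts G" "y \<in> pverts G" "x \<noteq> y"
    using assms(1) pair_no_loops[of "(x, y)"] by (auto dest: in_arcsD1 in_arcsD2)
  let ?R = "pverts G - {x} - {y}"
  have split: "potential G f \<zeta> = f x * \<zeta> x + (f y * \<zeta> y + (\<Sum>v \<in> ?R. f v * \<zeta> v))" for \<zeta>
    unfolding potential_def using xy pair_finite_verts
    by (simp add: sum.remove[of _ x] sum.remove[of _ y])
  have "(\<Sum>v \<in> ?R. f v * move \<eta> x y v) = (\<Sum>v \<in> ?R. f v * \<eta> v)"
    by (intro sum.cong) (auto simp: move_def)
  moreover obtain h where "\<eta> x = Suc h"
    using assms(2) gr0_implies_Suc by blast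
  ultimately show ?thesis
    using xy(3) unfolding split by (simp add: move_def)
qed

lemma pile_potential_le:
  assumes lip: "\<And>x y. (x, y) \<in> parcs G \<Longrightarrow> f y \<le> f x + 1"
    and \<omega>: "\<omega> \<in> pile_paths G \<eta>\<^sub>0"
  shows "potential G f (\<omega> t) \<le> potential G f \<eta>\<^sub>0 + t"
proof (induction t)
  case 0
  show ?case
    using \<omega> by (simp add: pile_paths_def)
next
  case (Suc t)
  have step: "\<omega> (Suc t) \<in> set_pmf (pile_step G (\<omega> t))"
    using \<omega> by (simp add: pile_paths_def set_pmf_iff less_le)
  have "potential G f (\<omega> (Suc t)) \<le> potential G f (\<omega> t) + 1"
  proof (cases "free_vertices G (\<omega> t) = {}")
    case True
    then show ?thesis
      using step by (simp add: pile_step_def)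
  next
    case False
    then obtain x y where xy: "\<omega> (Suc t) = move (\<omega> t) x y"
        "x \<in> free_vertices G (\<omega> t)" "y \<in> lowest_nbrs G (\<omega> t) x"
      using step set_pmf_pile_step[OF pair_graph_axioms False] by auto
    then have "(x, y) \<in> parcs G" "\<omega> t x > 0"
      by (auto simp: free_vertices_def lowest_nbrs_def nbrs_def)
    then show ?thesis
      using potential_move[of x y "\<omega> t" f] lip[of x y] xy(1) by simp
  qed
  then show ?case
    using Suc.IH by simp
qed

lemma potential_flat_pile: "potential G f (flat_pile G) = (\<Sum>v \<in> pverts G. f v)"
  by (simp add: potential_def flat_pile_def)

lemma potential_point_pile:
  assumes "f u = 0"
  shows "potential G f (point_pile n u) = 0"
  using assms by (simp add: potential_def point_pile_def)

lemma graph_dist_self: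
  assumes "u \<in> pverts G"
  shows "graph_dist G u u = 0"
  using graph_dist_le[of G u "[]" u] assms by (simp add: awalk_Nil_iff)

theorem hitting_time_flat_pile_ge:
  assumes "u \<in> pverts G"
    and reach: "\<And>v. v \<in> pverts G \<Longrightarrow> \<exists>p. awalk u p v"
    and \<omega>: "\<omega> \<in> pile_paths G (point_pile n u)"
  shows "enat (\<Sum>v \<in> pverts G. graph_dist G u v) \<le> hitting_time (flat_pile G) \<omega>"
  unfolding hitting_time_def
proof (rule INF_greatest)
  fix t assume "t \<in> {t. \<omega> t = flat_pile G}"
  moreover have "graph_dist G u y \<le> graph_dist G u x + 1" if "(x, y) \<in> parcs G" for x y
    using reach[of x] graph_dist_arc_le[OF _ that] that by (auto dest: in_arcsD1)
  ultimately show "enat (\<Sum>v \<in> pverts G. graph_dist G u v) \<le> enat t"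
    using pile_potential_le[OF _ \<omega>, of "graph_dist G u" t]
      potential_flat_pile[of "graph_dist G u"]
      potential_point_pile[of "graph_dist G u" u n, OF graph_dist_self[OF assms(1)]]
    by auto
qed

end


section \<open>Distances in the cycle\<close>

text \<open>
  The two remainders are the lengths of the paths from \<open>u\<close> to \<open>v\<close> in the two directions; adding
  \<open>n\<close> keeps the subtraction from truncating, and for \<open>u = v\<close> both are \<open>0\<close>.
\<close>

definition cycle_dist :: "nat \<Rightarrow> nat \<Rightarrow> nat \<Rightarrow> nat" where
  "cycle_dist n u v = min ((v + n - u) mod n) ((u + n - v) mod n)"

text \<open>Linear arithmetic can treat this form, which has no remainders.\<close>

lemma cycle_dist_cases:
  assumes "u < n" "v < n"
  shows "cycle_dist n u v = (if u \<le> v then min (v - u) (n - (v - u)) else min (u - v) (n - (u - v)))"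
proof -
  have less: "(a + n - b) mod n = n - (b - a)" if "a < b" "b < n" for a b
    using that by simp
  have ge: "(a + n - b) mod n = a - b" if "b \<le> a" "a < n" for a b
  proof -
    have "a + n - b = (a - b) + n"
      using that by simp
    then show ?thesis
      using that by (simp only: mod_add_self2) simp
  qed
  consider "u < v" | "u = v" | "v < u"
    by linarith
  then show ?thesis
    using assms less[of u v] less[of v u] ge[of u v] ge[of v u]
    by cases (simp_all add: cycle_dist_def min.commute)
qed

lemma Suc_mod_cases:
  fixes i n :: nat
  assumes "i < n"
  shows "(i + 1) mod n = (if i + 1 = n then 0 else i + 1)"
  using assms by (cases "i + 1 = n") simp_all

lemma cycle_arc_iff:
  "(i, j) \<in> parcs (cycle_graph n) \<longleftrightarrow>
    i < n \<and> j < n \<and> (j = (if i + 1 = n then 0 else i + 1) \<or> i = (if j + 1 = n then 0 else j + 1))"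
  unfolding cycle_graph_def by (auto simp: Suc_mod_cases simp del: One_nat_def)

text \<open>One of the two neighbours of \<open>v\<close> is the next vertex on a shortest path from \<open>v\<close> to \<open>u\<close>.\<close>

lemma cycle_dist_pred:
  assumes "u < n" "v < n" "cycle_dist n u v > 0"
  shows "\<exists>x. (x, v) \<in> parcs (cycle_graph n) \<and> cycle_dist n u v = cycle_dist n u x + 1"
proof -
  define s where "s = (if v + 1 = n then 0 else v + 1)"
  define p where "p = (if v = 0 then n - 1 else v - 1)"
  have lt: "s < n" "p < n"
    using assms by (auto simp: s_def p_def)
  have arcs: "(s, v) \<in> parcs (cycle_graph n)" "(p, v) \<in> parcs (cycle_graph n)"
    using assms lt by (auto simp: cycle_arc_iff s_def p_def)
  have "u \<noteq> v"
    using assms by (auto simp: cycle_dist_cases)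
  then consider "u < v" "2 * (v - u) \<le> n" | "u < v" "2 * (v - u) > n"
    | "v < u" "2 * (u - v) \<le> n" | "v < u" "2 * (u - v) > n"
    by linarith
  then have "cycle_dist n u v = cycle_dist n u s + 1 \<or> cycle_dist n u v = cycle_dist n u p + 1"
  proof cases
    case 1
    then have "u \<le> v - 1"
      by simp
    then have "cycle_dist n u v = v - u" "cycle_dist n u p + 1 = v - u"
      using 1 assms(1,2) lt by (simp_all add: cycle_dist_cases p_def Suc_diff_Suc)
    then show ?thesis
      by simp
  next
    case 2
    have "cycle_dist n u v = n - (v - u)"
      using 2 assms(1,2) by (simp add: cycle_dist_cases)
    moreover have "cycle_dist n u s + 1 = n - (v - u)"
    proof (cases "v + 1 = n")
      case True
      then show ?thesis
        using 2 assms(1) by (auto simp: cycle_dist_cases s_def)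
    next
      case False
      then show ?thesis
        using 2 assms(1) lt by (auto simp: cycle_dist_cases s_def)
    qed
    ultimately show ?thesis
      by simp
  next
    case 3
    then have "v + 1 \<le> u" "u \<le> v + 1 \<longleftrightarrow> u = v + 1"
      by auto
    then have "cycle_dist n u v = u - v" "cycle_dist n u s + 1 = u - v"
      using 3 assms(1,2) lt by (auto simp: cycle_dist_cases s_def)
    then show ?thesis
      by simp
  next
    case 4
    have "cycle_dist n u v = n - (u - v)"
      using 4 assms(1,2) by (simp add: cycle_dist_cases)
    moreover have "cycle_dist n u p + 1 = n - (u - v)"
    proof (cases "v = 0")
      case True
      then show ?thesis
        using 4 assms(1) by (auto simp: cycle_dist_cases p_def)
    next
      case False
      then show ?thesis
        using 4 assms(1) lt by (auto simp: cycle_dist_cases p_def)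
    qed
    ultimately show ?thesis
      by simp
  qed
  then show ?thesis
    using arcs by blast
qed

text \<open>
  With \<open>k\<close> the length of one path round the cycle and \<open>n - k\<close> that of the other, both lengths change
  by at most \<open>1\<close>, hence so does the smaller one.
\<close>

lemma min_arc_lipschitz:
  fixes k l n :: nat
  assumes "k \<le> l + 1" "l \<le> k + 1"
  shows "min k (n - k) \<le> min l (n - l) + 1"
proof -
  have "n - k \<le> n - l + 1"
    using assms by linarith
  then show ?thesis
    using assms(1) by (auto simp: min_def)
qed

lemma cycle_dist_lipschitz:
  assumes "u < n" "(x, y) \<in> parcs (cycle_graph n)"
  shows "cycle_dist n u y \<le> cycle_dist n u x + 1"
proof -
  define k where "k v = (if u \<le> v then v - u else u - v)" for v
  have dist: "cycle_dist n u v = min (k v) (n - k v)" if "v < n" for v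
    using cycle_dist_cases[OF assms(1) that] by (simp add: k_def)
  \<comment> \<open>Across the arc between \<open>n - 1\<close> and \<open>0\<close> the two ways round the cycle swap roles.\<close>
  have dist_0: "cycle_dist n u 0 = min (n - u) (n - (n - u))"
    using cycle_dist_cases[of u n 0] assms(1) by (cases "u = 0") (simp_all add: min.commute)
  have lt: "x < n" "y < n"
    using assms(2) by (auto simp: cycle_arc_iff)
  consider "y = x + 1" | "y = 0" "x + 1 = n" | "x = y + 1" | "x = 0" "y + 1 = n"
    using assms(2) by (auto simp: cycle_arc_iff split: if_splits)
  then show ?thesis
  proof cases
    case 1
    then show ?thesis
      unfolding dist[OF lt(1)] dist[OF lt(2)] by (intro min_arc_lipschitz) (auto simp: k_def)
  next
    case 2
    then show ?thesis
      unfolding dist[OF lt(1)] \<open>y = 0\<close> dist_0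
      using assms(1) by (intro min_arc_lipschitz) (auto simp: k_def)
  next
    case 3
    then show ?thesis
      unfolding dist[OF lt(1)] dist[OF lt(2)] by (intro min_arc_lipschitz) (auto simp: k_def)
  next
    case 4
    then show ?thesis
      unfolding dist[OF lt(2)] \<open>x = 0\<close> dist_0
      using assms(1) by (intro min_arc_lipschitz) (auto simp: k_def)
  qed
qed

lemma cycle_dist_eq_0_iff:
  assumes "u < n" "v < n"
  shows "cycle_dist n u v = 0 \<longleftrightarrow> v = u"
  using assms by (auto simp: cycle_dist_cases min_def)

lemma pverts_cycle_graph [simp]: "pverts (cycle_graph n) = {..<n}"
  by (simp add: cycle_graph_def)

lemma graph_dist_cycle:
  assumes "n \<ge> 3" "u < n" "v < n"
  shows "graph_dist (cycle_graph n) u v = cycle_dist n u v"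
proof -
  interpret pair_graph "cycle_graph n"
    using assms(1) by (rule pair_graph_cycle_graph)
  show ?thesis
  proof (rule graph_dist_eq_level)
    show "\<exists>x. (x, w) \<in> parcs (cycle_graph n) \<and> cycle_dist n u w = cycle_dist n u x + 1"
      if "w \<in> pverts (cycle_graph n)" "cycle_dist n u w > 0" for w
      using that assms(2) by (intro cycle_dist_pred) auto
    show "cycle_dist n u y \<le> cycle_dist n u x + 1" if "(x, y) \<in> parcs (cycle_graph n)" for x y
      using assms(2) that by (rule cycle_dist_lipschitz)
  qed (use assms in \<open>simp_all add: cycle_dist_eq_0_iff\<close>)
qed

lemma cycle_reachable:
  assumes "n \<ge> 3" "u < n" "v < n"
  shows "\<exists>p. pre_digraph.awalk (with_proj (cycle_graph n)) u p v"
proof -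
  interpret pair_graph "cycle_graph n"
    using assms(1) by (rule pair_graph_cycle_graph)
  have "\<exists>p. awalk u p v \<and> length p = cycle_dist n u v"
  proof (rule awalk_of_levels)
    show "\<exists>x. (x, w) \<in> parcs (cycle_graph n) \<and> cycle_dist n u w = cycle_dist n u x + 1"
      if "w \<in> pverts (cycle_graph n)" "cycle_dist n u w > 0" for w
      using that assms(2) by (intro cycle_dist_pred) auto
  qed (use assms in \<open>simp_all add: cycle_dist_eq_0_iff\<close>)
  then show ?thesis
    by blast
qed

text \<open>
  The sum for \<open>n + 2\<close> starts with \<open>0\<close>; its other \<open>n + 1\<close> summands, with \<open>k\<close> shifted by one place,
  exceed those for \<open>n\<close> by \<open>1\<close> each (the last of the latter, at \<open>k = n\<close>, being \<open>0\<close>). This matches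
  \<open>(n + 2)\<^sup>2 = n\<^sup>2 + 4 (n + 1)\<close>.
\<close>

lemma sum_min_eq: "(\<Sum>k<n. min k (n - k)) = n\<^sup>2 div 4" for n :: nat
proof (induction n rule: nat_induct2)
  case (step n)
  have "(\<Sum>k<n + 2. min k (n + 2 - k)) = (\<Sum>k<n + 1. min (Suc k) (Suc (n - k)))"
    by (subst add_2_eq_Suc', subst sum.lessThan_Suc_shift) (auto intro!: sum.cong simp: Suc_diff_le)
  also have "\<dots> = (\<Sum>k<n + 1. min k (n - k) + 1)"
    by (intro sum.cong) auto
  also have "\<dots> = (\<Sum>k<n. min k (n - k)) + (n + 1)"
    by (simp only: sum.distrib) simp
  also have "\<dots> = (n\<^sup>2 + 4 * (n + 1)) div 4"
    using step by simp
  also have "n\<^sup>2 + 4 * (n + 1) = (n + 2)\<^sup>2"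
    by (simp add: power2_eq_square algebra_simps)
  finally show ?case .
qed auto

lemma sum_cycle_dist:
  assumes "u < n"
  shows "(\<Sum>v<n. cycle_dist n u v) = n\<^sup>2 div 4"
proof -
  have "(\<Sum>v<n. cycle_dist n u v) = (\<Sum>k<n. min k (n - k))"
    \<comment> \<open>Rotate \<open>u\<close> to \<open>0\<close>.\<close>
    by (rule sum.reindex_bij_witness[of _ "\<lambda>k. if u + k < n then u + k else u + k - n"
          "\<lambda>v. if u \<le> v then v - u else v + n - u"])
      (use assms in \<open>auto simp: cycle_dist_cases min_def split: if_splits\<close>)
  then show ?thesis
    by (simp add: sum_min_eq)
qed

lemma sum_graph_dist_cycle:
  assumes "n \<ge> 3" "u < n"
  shows "(\<Sum>v \<in> pverts (cycle_graph n). graph_dist (cycle_graph n) u v) = n\<^sup>2 div 4"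
  using assms sum_cycle_dist[of u n] by (simp add: graph_dist_cycle)


section \<open>The quadratic lower bound\<close>

lemma cycle_hitting_time_ge:
  assumes "n \<ge> 3" "u < n" "\<omega> \<in> pile_paths (cycle_graph n) (point_pile n u)"
  shows "enat (n\<^sup>2 div 4) \<le> hitting_time (flat_pile (cycle_graph n)) \<omega>"
  using pair_graph.hitting_time_flat_pile_ge[OF pair_graph_cycle_graph, of n u \<omega> n]
    assms cycle_reachable sum_graph_dist_cycle[of n u] by simp

lemma cycle_AE_hitting_time_ge:
  assumes "n \<ge> 3" "u < n"
  shows "AE \<omega> in pile_process (cycle_graph n) (point_pile n u).
    enat (n\<^sup>2 div 4) \<le> hitting_time (flat_pile (cycle_graph n)) \<omega>"
  using AE_pile_paths by (rule eventually_mono) (use assms in \<open>rule cycle_hitting_time_ge\<close>)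

lemma cycle_expected_hitting_time_ge:
  assumes "n \<ge> 3" "u < n"
  shows "(\<integral>\<^sup>+ \<omega>. ennreal_of_enat (hitting_time (flat_pile (cycle_graph n)) \<omega>)
      \<partial>pile_process (cycle_graph n) (point_pile n u)) \<ge> of_nat (n\<^sup>2 div 4)"
    (is "?E \<ge> _")
proof -
  interpret prob_space "pile_process (cycle_graph n) (point_pile n u)"
    by (rule prob_space_pile_process)
  have "of_nat (n\<^sup>2 div 4) =
      (\<integral>\<^sup>+ \<omega>. ennreal_of_enat (enat (n\<^sup>2 div 4)) \<partial>pile_process (cycle_graph n) (point_pile n u))"
    using emeasure_space_1 by simp
  also have "\<dots> \<le> ?E"
    using cycle_AE_hitting_time_ge[OF assms]
    by (intro nn_integral_mono_AE) (auto elim!: eventually_mono simp: of_nat_eq_enat)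
  finally show ?thesis .
qed

theorem theorem5p1:
  shows
    "(\<forall>n\<ge>3. \<forall>u \<in> pverts (cycle_graph n).
        let T = (\<Sum>v \<in> pverts (cycle_graph n). graph_dist (cycle_graph n) u v) in
          int T = \<lfloor>(real n)\<^sup>2 / 4\<rfloor> \<and>
          (\<forall>\<omega> \<in> pile_paths (cycle_graph n) (point_pile n u).
             hitting_time (flat_pile (cycle_graph n)) \<omega> \<ge> enat T) \<and>
          (AE \<omega> in pile_process (cycle_graph n) (point_pile n u).
             hitting_time (flat_pile (cycle_graph n)) \<omega> \<ge> enat T)) \<and>
     (\<exists>c>0. \<forall>\<^sub>F n in sequentially. \<forall>u \<in> pverts (cycle_graph n).
        (\<integral>\<^sup>+ \<omega>. ennreal_of_enat (hitting_time (flat_pile (cycle_graph n)) \<omega>)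
           \<partial>pile_process (cycle_graph n) (point_pile n u)) \<ge> ennreal (c * (real n)\<^sup>2))"
proof (intro conjI allI impI ballI)
  fix n u :: nat
  assume n: "n \<ge> 3" and "u \<in> pverts (cycle_graph n)"
  then have u: "u < n"
    by simp
  have "int (n\<^sup>2 div 4) = \<lfloor>(real n)\<^sup>2 / 4\<rfloor>"
    using floor_divide_of_nat_eq[of "n\<^sup>2" 4, where ?'a = real] by simp
  then show "let T = (\<Sum>v \<in> pverts (cycle_graph n). graph_dist (cycle_graph n) u v) in
          int T = \<lfloor>(real n)\<^sup>2 / 4\<rfloor> \<and>
          (\<forall>\<omega> \<in> pile_paths (cycle_graph n) (point_pile n u).
             hitting_time (flat_pile (cycle_graph n)) \<omega> \<ge> enat T) \<and>
          (AE \<omega> in pile_process (cycle_graph n) (point_pile n u).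
             hitting_time (flat_pile (cycle_graph n)) \<omega> \<ge> enat T)"
    unfolding Let_def sum_graph_dist_cycle[OF n u]
    using cycle_hitting_time_ge[OF n u] cycle_AE_hitting_time_ge[OF n u] by blast
next
  \<comment> \<open>Rounding down costs less than \<open>1 \<le> n\<^sup>2 / 8\<close>, so half of the leading constant \<open>1 / 4\<close> survives.\<close>
  have bound: "(real n)\<^sup>2 / 8 \<le> real (n\<^sup>2 div 4)" if "n \<ge> 3" for n :: nat
  proof -
    have "3\<^sup>2 \<le> n\<^sup>2"
      using that by (intro power_mono) auto
    then have "n\<^sup>2 \<le> 8 * (n\<^sup>2 div 4)"
      by simp
    then have "real (n\<^sup>2) \<le> real (8 * (n\<^sup>2 div 4))"
      by (simp only: of_nat_le_iff)
    then show ?thesis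
      by simp
  qed
  have "ennreal (1 / 8 * (real n)\<^sup>2) \<le>
      (\<integral>\<^sup>+ \<omega>. ennreal_of_enat (hitting_time (flat_pile (cycle_graph n)) \<omega>)
           \<partial>pile_process (cycle_graph n) (point_pile n u))" if "n \<ge> 3" "u < n" for n u
  proof -
    have "ennreal (1 / 8 * (real n)\<^sup>2) \<le> of_nat (n\<^sup>2 div 4)"
      using bound[OF that(1)] by (simp add: ennreal_leI flip: ennreal_of_nat_eq_real_of_nat)
    then show ?thesis
      using cycle_expected_hitting_time_ge[OF that] by (rule order_trans)
  qed
  then have "\<forall>\<^sub>F n in sequentially. \<forall>u \<in> pverts (cycle_graph n).
      ennreal (1 / 8 * (real n)\<^sup>2) \<le>
      (\<integral>\<^sup>+ \<omega>. ennreal_of_enat (hitting_time (flat_pile (cycle_graph n)) \<omega>)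
           \<partial>pile_process (cycle_graph n) (point_pile n u))"
    unfolding eventually_sequentially by auto
  then show "\<exists>c>0. \<forall>\<^sub>F n in sequentially. \<forall>u \<in> pverts (cycle_graph n).
        (\<integral>\<^sup>+ \<omega>. ennreal_of_enat (hitting_time (flat_pile (cycle_graph n)) \<omega>)
           \<partial>pile_process (cycle_graph n) (point_pile n u)) \<ge> ennreal (c * (real n)\<^sup>2)"
    by (intro exI[of _ "1 / 8"]) auto
qed

end
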